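(* Let $U\subset\mathbb{R}$ be a neighborhood of $0$ and let $f:U\to f(U)\subset\mathbb{R}$ be a homeomorphism of $U$ onto its image with $f(0)=0$. Assume that there exist numbers $a,A>0$ such that, whenever $|x|\leq A$ and $0<v<a$, the points $x$, $x+v$, $x-v$ belong to $U$ and $$f(x+v)-f(x)>v,\qquad f(x-v)-f(x)<-v .$$ Then $f$ has the finite shadowing property in the set $\mathcal{B}=[-A,A]$.
   Context: Finite $d$-pseudotrajectory: for $d>0$, a finite set of points $\{p_k:\ 0\leq k\leq m\}$ such that $|f(p_k)-p_{k+1}|\leq d$ for $0\leq k\leq m-1$. Finite shadowing property in a set $K$: for any $\varepsilon>0$ there exists $d>0$ (depending on $K$ and $\varepsilon$ but not on $m$) such that, for every $m$ and every $d$-pseudotrajectory $\{p_k:\ 0\leq k\leq m\}$ of $f$ with all $p_k\in K$, there exists a point $r$ such that the iterates $f^k(r)$, $0\leq k\leq m$, are defined and $|f^k(r)-p_k|\leq\varepsilon$ for $0\leq k\leq m$. *)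

theory Defs
  imports "HOL-Analysis.Analysis"
begin

text \<open>
  A map \<open>f : U \<rightarrow> \<real>\<close> with \<open>U \<subseteq> \<real>\<close> is represented by a total function together with its domain
  \<open>U\<close>; no definition below depends on the values of \<open>f\<close> outside \<open>U\<close>.
\<close>

text \<open>
  Only the values \<open>p 0, \<dots>, p m\<close> of the sequence matter. The condition \<open>p k \<in> U\<close> says that
  \<open>f (p k)\<close> is defined; none is needed for the last point \<open>p m\<close>.
\<close>

definition pseudotrajectory ::
  "real set \<Rightarrow> (real \<Rightarrow> real) \<Rightarrow> real \<Rightarrow> nat \<Rightarrow> (nat \<Rightarrow> real) \<Rightarrow> bool" where
  "pseudotrajectory U f d m p \<longleftrightarrow>
     (\<forall>k<m. p k \<in> U \<and> \<bar>f (p k) - p (Suc k)\<bar> \<le> d)"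

text \<open>
  The domain of the partial map \<open>f\<^sup>k\<close>, where \<open>f\<^sup>0\<close> is the identity of \<open>U\<close>. The value \<open>f\<^sup>k(r)\<close>
  itself need not lie in \<open>U\<close> for \<open>k \<ge> 1\<close>.
\<close>

definition iterate_defined :: "real set \<Rightarrow> (real \<Rightarrow> real) \<Rightarrow> nat \<Rightarrow> real \<Rightarrow> bool" where
  "iterate_defined U f k r \<longleftrightarrow> r \<in> U \<and> (\<forall>j<k. (f ^^ j) r \<in> U)"

definition finite_shadowing_property ::
  "real set \<Rightarrow> (real \<Rightarrow> real) \<Rightarrow> real set \<Rightarrow> bool" where
  "finite_shadowing_property U f K \<longleftrightarrow>
     (\<forall>\<epsilon>>0. \<exists>d>0. \<forall>m p.
        pseudotrajectory U f d m p \<and> (\<forall>k\<le>m. p k \<in> K) \<longrightarrow>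
        (\<exists>r. \<forall>k\<le>m. iterate_defined U f k r \<and> \<bar>(f ^^ k) r - p k\<bar> \<le> \<epsilon>))"

end

theory Submission
  imports Defs
begin

text \<open>
  By compactness of \<open>[-A, A]\<close>, for fixed \<open>e < a\<close> the expansion inequalities hold at distance \<open>e\<close>
  with a uniform margin \<open>d\<close>. Hence \<open>f\<close> maps the closed interval of radius \<open>e\<close> around \<open>p\<^sub>k\<close> over
  the one around \<open>p\<^sub>k\<^sub>+\<^sub>1\<close> for every \<open>d\<close>-pseudotrajectory, and pulling a point back along this
  chain of coverings yields the shadowing point.
\<close>

text \<open>The point \<open>y\<close> is pulled back one covering at a time, starting from the
  last. Prescribing the endpoint exactly, and not only its membership in \<open>I m\<close>, is what
  lets the induction continue from a chosen preimage of \<open>y\<close>.\<close>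

lemma orbit_through_covering_chain:
  fixes f :: "'a \<Rightarrow> 'a" and I :: "nat \<Rightarrow> 'a set"
  assumes "\<And>k. k < m \<Longrightarrow> I (Suc k) \<subseteq> f ` I k" and "y \<in> I m"
  shows "\<exists>r. (\<forall>k\<le>m. (f ^^ k) r \<in> I k) \<and> (f ^^ m) r = y"
  using assms
proof (induction m arbitrary: y)
  case 0
  then show ?case by auto
next
  case (Suc m)
  then obtain x where x: "x \<in> I m" "f x = y" by blast
  with Suc.IH[of x] Suc.prems(1) obtain r
    where "\<forall>k\<le>m. (f ^^ k) r \<in> I k" "(f ^^ m) r = x" by auto
  with x Suc.prems(2) show ?case
    by (intro exI[of _ r]) (auto simp: le_Suc_eq)
qed

lemma compact_pos_lower_bound:
  fixes h :: "'a::topological_space \<Rightarrow> real"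
  assumes "compact K" and "continuous_on K h" and "\<And>x. x \<in> K \<Longrightarrow> h x > 0"
  obtains d where "d > 0" and "\<And>x. x \<in> K \<Longrightarrow> d \<le> h x"
proof (cases "K = {}")
  case True
  then show ?thesis using that[of 1] by simp
next
  case False
  then obtain z where "z \<in> K" "\<forall>x\<in>K. h z \<le> h x"
    using continuous_attains_inf assms(1,2) by blast
  then show ?thesis using that[of "h z"] assms(3) by blast
qed

theorem theorem2p1:
  fixes U :: "real set" and f :: "real \<Rightarrow> real" and a A :: real
  assumes "0 \<in> interior U"
    and "\<exists>g. homeomorphism U (f ` U) f g"
    and "f 0 = 0"
    and "a > 0" and "A > 0"
    and "\<And>x v. \<bar>x\<bar> \<le> A \<Longrightarrow> 0 < v \<Longrightarrow> v < a \<Longrightarrow>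
           x \<in> U \<and> x + v \<in> U \<and> x - v \<in> U \<and>
           f (x + v) - f x > v \<and> f (x - v) - f x < - v"
  shows "finite_shadowing_property U f {-A..A}"
  unfolding finite_shadowing_property_def
proof (intro allI impI)
  fix \<epsilon> :: real
  assume "\<epsilon> > 0"
  \<comment> \<open>Halving \<open>a\<close> gives the strict bound \<open>e < a\<close>, so the
    expansion hypothesis applies at \<open>v = e\<close> itself.\<close>
  define e where "e = min \<epsilon> (a / 2)"
  have e: "0 < e" "e < a" "e \<le> \<epsilon>"
    using \<open>\<epsilon> > 0\<close> \<open>a > 0\<close> by (auto simp: e_def)
  have cont: "continuous_on U f"
    using assms(2) by (auto simp: homeomorphism_def)
  \<comment> \<open>\<open>U\<close> may be disconnected, so each point of the interval is reached
    separately, taking for \<open>v\<close> its distance to \<open>x\<close>.\<close>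
  have sub: "{x - e..x + e} \<subseteq> U" if "\<bar>x\<bar> \<le> A" for x
  proof
    fix y assume y: "y \<in> {x - e..x + e}"
    consider "y = x" | "y > x" | "y < x" by linarith
    then show "y \<in> U"
    proof cases
      case 1 then show ?thesis using assms(6)[OF that e(1,2)] by simp
    next
      case 2 then show ?thesis using assms(6)[OF that, of "y - x"] y e by simp
    next
      case 3 then show ?thesis using assms(6)[OF that, of "x - y"] y e by simp
    qed
  qed
  \<comment> \<open>The smaller of the two amounts by which the images of \<open>x + e\<close> and
    \<open>x - e\<close> overshoot \<open>f x + e\<close> and \<open>f x - e\<close>.\<close>
  let ?h = "\<lambda>x. min (f (x + e) - f x - e) (f x - f (x - e) - e)"
  have "x \<in> U \<and> x + e \<in> U \<and> x - e \<in> U" if "x \<in> {-A..A}" for x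
    using assms(6)[OF _ e(1,2), of x] that by (auto simp: abs_le_iff)
  then have "{-A..A} \<subseteq> U" "(\<lambda>x. x + e) ` {-A..A} \<subseteq> U" "(\<lambda>x. x - e) ` {-A..A} \<subseteq> U"
    by blast+
  then have "continuous_on {-A..A} ?h"
    by (intro continuous_intros continuous_on_compose2[OF cont]) simp_all
  moreover have "?h x > 0" if "x \<in> {-A..A}" for x
    using assms(6)[OF _ e(1,2), of x] that by (auto simp: abs_le_iff)
  ultimately obtain d where d: "d > 0" "\<And>x. x \<in> {-A..A} \<Longrightarrow> d \<le> ?h x"
    using compact_pos_lower_bound[of "{-A..A}" ?h] by blast
  have "\<exists>r. \<forall>k\<le>m. iterate_defined U f k r \<and> \<bar>(f ^^ k) r - p k\<bar> \<le> \<epsilon>"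
    if p: "pseudotrajectory U f d m p" "\<forall>k\<le>m. p k \<in> {-A..A}" for m p
  proof -
    define I where "I k = {p k - e..p k + e}" for k
    have I_sub: "I k \<subseteq> U" if "k \<le> m" for k
      unfolding I_def using sub[of "p k"] p(2) that by fastforce
    have "I (Suc k) \<subseteq> f ` I k" if "k < m" for k
    proof
      fix y assume y: "y \<in> I (Suc k)"
      have "\<bar>f (p k) - p (Suc k)\<bar> \<le> d"
        using p(1) that by (simp add: pseudotrajectory_def)
      moreover have "d \<le> ?h (p k)"
        using d(2) p(2) that by simp
      \<comment> \<open>The margin absorbs the jump: \<open>f (p k + e) \<ge> f (p k) + e + d \<ge>
        p (Suc k) + e \<ge> y\<close>, and symmetrically on the left.\<close>
      ultimately have "f (p k - e) \<le> y" "y \<le> f (p k + e)"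
        using y unfolding I_def by auto
      moreover have "continuous_on {p k - e..p k + e} f"
        using continuous_on_subset[OF cont I_sub[of k]] that by (simp add: I_def)
      ultimately show "y \<in> f ` I k"
        using IVT'[of f "p k - e" y "p k + e"] e(1) by (force simp: I_def)
    qed
    moreover have "p m \<in> I m"
      using e(1) by (simp add: I_def)
    ultimately obtain r where r: "\<And>k. k \<le> m \<Longrightarrow> (f ^^ k) r \<in> I k"
      using orbit_through_covering_chain[of m I f "p m"] by blast
    have "(f ^^ k) r \<in> U" if "k \<le> m" for k
      using r I_sub that by blast
    \<comment> \<open>For \<open>k = 0\<close> the condition over \<open>j < k\<close> is vacuous,
      so \<open>iterate_defined\<close> asks for \<open>r \<in> U\<close> separately.\<close>
    moreover from this[of 0] have "r \<in> U" by simp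
    moreover have "\<bar>(f ^^ k) r - p k\<bar> \<le> \<epsilon>" if "k \<le> m" for k
      using r[OF that] e(3) by (auto simp: I_def)
    ultimately show ?thesis
      by (intro exI[of _ r]) (auto simp: iterate_defined_def)
  qed
  with d(1) show "\<exists>d>0. \<forall>m p. pseudotrajectory U f d m p \<and> (\<forall>k\<le>m. p k \<in> {-A..A}) \<longrightarrow>
      (\<exists>r. \<forall>k\<le>m. iterate_defined U f k r \<and> \<bar>(f ^^ k) r - p k\<bar> \<le> \<epsilon>)"
    by blast
qed

end
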